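(* Let $a\in\mathbb{R}$, $0<\nu<1$, $p:\mathbb{N}_{a+1}\to(0,\infty)$, $q:\mathbb{N}_{a+1}\to\mathbb{R}$, and let $(L_ay)(t)=\nabla[p(t+1)\nabla_{a*}^{\nu}y(t+1)]+q(t)y(t)$ for $y:\mathbb{N}_a\to\mathbb{R}$, $t\in\mathbb{N}_{a+1}$. Let $h:\mathbb{N}_{a+1}\to\mathbb{R}$. Then the solution $y:\mathbb{N}_a\to\mathbb{R}$ of the initial value problem $$L_ay(t)=h(t)\ \ (t\in\mathbb{N}_{a+1}),\qquad y(a)=0,\qquad \nabla y(a+1)=0,$$ is given by $$y(t)=\int_a^t x(t,s)h(s)\,\nabla s,\qquad t\in\mathbb{N}_a,$$ where $x(t,s)$ is the Cauchy function for $L_a$.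
   Context: For $a\in\mathbb{R}$, $\mathbb{N}_a=\{a,a+1,a+2,\dots\}$. The nabla difference is $\nabla f(t)=f(t)-f(t-1)$ (for functions of $(t,s)$ it acts in $t$). The definite nabla integral is $\int_c^d f(s)\nabla s=\sum_{s=c+1}^d f(s)$ if $c<d$, and $0$ if $d\le c$. The generalized rising function is $t^{\overline{\mu}}=\Gamma(t+\mu)/\Gamma(t)$, with the convention $t^{\overline{\mu}}=0$ if $t$ is a non-positive integer and $t+\mu$ is not a non-positive integer. For $\mu>0$, the nabla fractional sum based at $a$ is $\nabla_a^{-\mu}f(t)=\sum_{s=a+1}^t\frac{(t-s+1)^{\overline{\mu-1}}}{\Gamma(\mu)}f(s)$ for $t\in\mathbb{N}_a$ (empty sums are $0$). For $0<\nu<1$ the Caputo nabla fractional difference based at $a$ is $\nabla_{a*}^{\nu}x(t)=\nabla_a^{-(1-\nu)}(\nabla x)(t)=\sum_{\tau=a+1}^{t}\frac{(t-\tau+1)^{\overline{-\nu}}}{\Gamma(1-\nu)}\nabla x(\tau)$ for $t\in\mathbb{N}_a$; $\nabla_{a*}^{\nu}x(t+1)$ denotes its value at $t+1$. In $L_a$ the outer $\nabla$ acts in $t$, so $\nabla[p(t+1)\nabla_{a*}^{\nu}x(t+1)]=p(t+1)\nabla_{a*}^{\nu}x(t+1)-p(t)\nabla_{a*}^{\nu}x(t)$. For $s\in\mathbb{N}_a$, $L_s$ denotes the same operator with base point $a$ replaced by $s$: $(L_sx)(t)=\nabla[p(t+1)\nabla_{s*}^{\nu}x(t+1)]+q(t)x(t)$,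 $t\in\mathbb{N}_{s+1}$, for $x:\mathbb{N}_s\to\mathbb{R}$. The Cauchy function for $L_a$ is the function $x(t,s)$ ($s\in\mathbb{N}_a$, $t\in\mathbb{N}_s$) such that, for each fixed $s\in\mathbb{N}_a$, $x(\cdot,s)$ solves the initial value problem $L_sx(t,s)=0$ for $t\in\mathbb{N}_{s+1}$, $x(s,s)=0$, $\nabla x(s+1,s)=\frac{1}{p(s+1)}$. *)

theory Defs
  imports "HOL-Analysis.Analysis"
begin

text \<open>
  A function on \<open>nats_from a\<close> is represented by a total function on the reals, of which only the
  values on \<open>nats_from a\<close> are ever used.
\<close>

definition nats_from :: "real \<Rightarrow> real set" where
  "nats_from a = {a + real k | k. True}"

definition nabla :: "(real \<Rightarrow> real) \<Rightarrow> real \<Rightarrow> real" where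
  "nabla f t = f t - f (t - 1)"

definition nabla_integral :: "real \<Rightarrow> real \<Rightarrow> (real \<Rightarrow> real) \<Rightarrow> real" where
  "nabla_integral c d f =
     (if c < d then (\<Sum>s \<in> {s \<in> nats_from (c + 1). s \<le> d}. f s) else 0)"

definition rising :: "real \<Rightarrow> real \<Rightarrow> real" where
  "rising t \<mu> =
     (if t \<in> \<int>\<^sub>\<le>\<^sub>0 \<and> t + \<mu> \<notin> \<int>\<^sub>\<le>\<^sub>0 then 0 else Gamma (t + \<mu>) / Gamma t)"

definition nabla_frac_sum :: "real \<Rightarrow> real \<Rightarrow> (real \<Rightarrow> real) \<Rightarrow> real \<Rightarrow> real" where
  "nabla_frac_sum a \<mu> f t =
     (\<Sum>s \<in> {s \<in> nats_from (a + 1). s \<le> t}. rising (t - s + 1) (\<mu> - 1) / Gamma \<mu> * f s)"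

definition caputo_nabla :: "real \<Rightarrow> real \<Rightarrow> (real \<Rightarrow> real) \<Rightarrow> real \<Rightarrow> real" where
  "caputo_nabla a \<nu> x t = nabla_frac_sum a (1 - \<nu>) (nabla x) t"

text \<open>The base point \<open>a\<close> is a parameter, since the Cauchy function involves all base points
  \<open>s \<in> nats_from a\<close>.\<close>

definition L_op ::
  "real \<Rightarrow> real \<Rightarrow> (real \<Rightarrow> real) \<Rightarrow> (real \<Rightarrow> real) \<Rightarrow> (real \<Rightarrow> real) \<Rightarrow> real \<Rightarrow> real" where
  "L_op a \<nu> p q x t =
     nabla (\<lambda>u. p (u + 1) * caputo_nabla a \<nu> x (u + 1)) t + q t * x t"

text \<open>Only the values \<open>x t s\<close> with \<open>s \<in> nats_from a\<close> and \<open>t \<in> nats_from s\<close> are constrained.\<close>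

definition is_Cauchy_function ::
  "real \<Rightarrow> real \<Rightarrow> (real \<Rightarrow> real) \<Rightarrow> (real \<Rightarrow> real) \<Rightarrow> (real \<Rightarrow> real \<Rightarrow> real) \<Rightarrow> bool" where
  "is_Cauchy_function a \<nu> p q x \<longleftrightarrow>
     (\<forall>s \<in> nats_from a.
        (\<forall>t \<in> nats_from (s + 1). L_op s \<nu> p q (\<lambda>u. x u s) t = 0) \<and>
        x s s = 0 \<and>
        nabla (\<lambda>u. x u s) (s + 1) = 1 / p (s + 1))"

end

(* Since x(s,s) = 0 and the Caputo difference based at s of a function agrees with a convolution
   of its nabla differences over s+1, ..., t, interchanging the two triangular sums turns the Caputo
   difference (based at a) of the integral of x(t,s)h(s) into the sum of h(s) times the Caputo
   difference of x(.,s) based at s.  Applying the outer difference, all terms cancel except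
   the newly appearing s = t, which contributes p(t+1) (1/p(t+1)) h(t) = h(t).  Uniqueness is forward
   recursion: the leading coefficient of y(t+1) in L_a y(t) is p(t+1) > 0. *)

theory Submission
  imports Defs
begin

text \<open>Re-indexing by natural numbers: every summation range of the development lies on the
  grid \<open>a + real j\<close>, so sums over sets of reals become sums over intervals of
  \<open>nat\<close>.\<close>

lemma nats_from_shift_eq:
  "{s \<in> nats_from (a + real i + 1). s \<le> a + real n} = (\<lambda>j. a + real j) ` {i<..n}"
proof (intro set_eqI iffI)
  fix s assume "s \<in> {s \<in> nats_from (a + real i + 1). s \<le> a + real n}"
  then obtain k where k: "s = a + real (i + 1 + k)" "s \<le> a + real n"
    by (auto simp: nats_from_def)
  then have "i + 1 + k \<le> n"
    by linarith
  with k(1) show "s \<in> (\<lambda>j. a + real j) ` {i<..n}"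
    by (intro image_eqI[of _ _ "i + 1 + k"]) auto
next
  fix s assume "s \<in> (\<lambda>j. a + real j) ` {i<..n}"
  then obtain j where j: "s = a + real j" "i < j" "j \<le> n"
    by auto
  then have "s = a + real i + 1 + real (j - i - 1)"
    by simp
  moreover have "s \<le> a + real n"
    using j by simp
  ultimately show "s \<in> {s \<in> nats_from (a + real i + 1). s \<le> a + real n}"
    unfolding nats_from_def by blast
qed

lemma sum_nats_from:
  "(\<Sum>s \<in> {s \<in> nats_from (a + real i + 1). s \<le> a + real n}. f s) = (\<Sum>j\<in>{i<..n}. f (a + real j))"
  unfolding nats_from_shift_eq by (subst sum.reindex) (auto simp: inj_on_def)

lemma nabla_integral_eq_sum:
  "nabla_integral a (a + real n) f = (\<Sum>i\<in>{0<..n}. f (a + real i))"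
  using sum_nats_from[where a = a and i = 0 and n = n and f = f] by (auto simp: nabla_integral_def)

lemma nabla_at_Suc: "nabla f (a + real (Suc n)) = f (a + real (Suc n)) - f (a + real n)"
  by (simp add: nabla_def algebra_simps)

text \<open>The weight of a nabla difference in the Caputo sum depends only on the lag
  \<open>m\<close>, not on the base point. One kernel therefore serves \<open>a\<close> and all the
  base points \<open>a + real i\<close>.\<close>

definition caputo_kernel :: "real \<Rightarrow> nat \<Rightarrow> real" where
  "caputo_kernel \<nu> m = rising (real m + 1) (- \<nu>) / Gamma (1 - \<nu>)"

lemma caputo_kernel_0:
  assumes "\<nu> < 1"
  shows "caputo_kernel \<nu> 0 = 1"
proof -
  \<comment> \<open>This rules out the default value 0 of \<open>rising\<close>, which leaves the
    Gamma quotient with \<open>Gamma 1 = 1\<close>.\<close>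
  have "(1::real) \<notin> \<int>\<^sub>\<le>\<^sub>0"
    by (auto elim!: nonpos_Ints_cases)
  moreover have "Gamma (1 - \<nu>) > 0"
    using assms by (intro Gamma_real_pos) auto
  ultimately show ?thesis
    by (simp add: caputo_kernel_def rising_def)
qed

lemma caputo_nabla_eq_sum:
  "caputo_nabla (a + real i) \<nu> f (a + real n) =
     (\<Sum>j\<in>{i<..n}. caputo_kernel \<nu> (n - j) * nabla f (a + real j))"
  unfolding caputo_nabla_def nabla_frac_sum_def sum_nats_from
  by (intro sum.cong) (auto simp: caputo_kernel_def of_nat_diff)

lemma L_op_eq:
  "L_op b \<nu> p q f (a + real n) =
     p (a + real (Suc n)) * caputo_nabla b \<nu> f (a + real (Suc n))
     - p (a + real n) * caputo_nabla b \<nu> f (a + real n) + q (a + real n) * f (a + real n)"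
  by (simp add: L_op_def nabla_def algebra_simps)

text \<open>The Caputo sum remembers all earlier differences, hence strong induction. The initial
  data settle \<open>n = 0\<close> and \<open>n = 1\<close>; for larger \<open>n\<close> the
  equation at the preceding point, which then lies in \<open>nats_from (a + 1)\<close>, fixes the
  next value.\<close>

lemma ivp_unique:
  assumes "\<nu> < 1"
    and p: "\<And>t. t \<in> nats_from (a + 1) \<Longrightarrow> p t \<noteq> 0"
    and L: "\<And>t. t \<in> nats_from (a + 1) \<Longrightarrow> L_op a \<nu> p q y t = L_op a \<nu> p q z t"
    and init: "y a = z a" "nabla y (a + 1) = nabla z (a + 1)"
  shows "y (a + real n) = z (a + real n)"
proof (induction n rule: less_induct)
  case (less n)
  consider "n = 0" | "n = 1" | m where "n = Suc (Suc m)"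
    by (metis One_nat_def not0_implies_Suc)
  then show ?case
  proof cases
    case 3
    have nb: "nabla y (a + real j) = nabla z (a + real j)" if "0 < j" "j < n" for j
    proof (cases j)
      case (Suc k)
      then show ?thesis
        using less.IH[of j] less.IH[of k] that unfolding Suc nabla_at_Suc by simp
    qed (use that in simp)
    have C: "caputo_nabla a \<nu> y (a + real (Suc m)) = caputo_nabla a \<nu> z (a + real (Suc m))"
      using caputo_nabla_eq_sum[of a 0 \<nu> y "Suc m"] caputo_nabla_eq_sum[of a 0 \<nu> z "Suc m"] nb
      by (simp add: 3 del: of_nat_Suc)
    \<comment> \<open>The newest difference has lag 0, hence weight 1, so it can be recovered from
      the Caputo value and the older differences.\<close>
    have head: "caputo_nabla a \<nu> f (a + real n) =
        nabla f (a + real n) + (\<Sum>j\<in>{0<..<n}. caputo_kernel \<nu> (n - j) * nabla f (a + real j))" for f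
    proof -
      have "{0<..n} = insert n {0<..<n}"
        using 3 by auto
      then show ?thesis
        using caputo_nabla_eq_sum[of a 0 \<nu> f n] caputo_kernel_0[OF \<open>\<nu> < 1\<close>] by simp
    qed
    have "a + real (Suc m) \<in> nats_from (a + 1)" "a + real n \<in> nats_from (a + 1)"
      unfolding nats_from_def 3 by (auto intro: exI[of _ m] exI[of _ "Suc m"])
    \<comment> \<open>In \<open>L_op\<close> at \<open>a + real (Suc m)\<close> all terms except the
      leading one are already known to agree; cancel \<open>p (a + real n)\<close>.\<close>
    then have "caputo_nabla a \<nu> y (a + real n) = caputo_nabla a \<nu> z (a + real n)"
      using L[of "a + real (Suc m)"] C p[of "a + real n"] less.IH[of "Suc m"]
      unfolding L_op_eq by (simp add: 3 del: of_nat_Suc)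
    then have "nabla y (a + real n) = nabla z (a + real n)"
      using nb by (simp add: head)
    then show ?thesis
      using less.IH[of "Suc m"] unfolding 3 nabla_at_Suc by (simp del: of_nat_Suc)
  qed (use init in \<open>auto simp: nabla_def\<close>)
qed

text \<open>The strict bound \<open>i < j\<close> matches a Caputo sum based at
  \<open>a + real i\<close>, whose first term is at \<open>i + 1\<close>.\<close>

lemma sum_triangle_swap:
  fixes g :: "nat \<Rightarrow> nat \<Rightarrow> 'a::comm_monoid_add"
  shows "(\<Sum>j\<in>{0<..n}. \<Sum>i\<in>{0<..<j}. g i j) = (\<Sum>i\<in>{0<..<n}. \<Sum>j\<in>{i<..n}. g i j)"
proof -
  have "(\<Sum>j\<in>{0<..n}. \<Sum>i\<in>{0<..<j}. g i j) = (\<Sum>j\<in>{0<..n}. \<Sum>i | i \<in> {0<..<n} \<and> i < j. g i j)"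
    by (intro sum.cong) auto
  also have "\<dots> = (\<Sum>i\<in>{0<..<n}. \<Sum>j | j \<in> {0<..n} \<and> i < j. g i j)"
    by (rule sum.swap_restrict) auto
  also have "\<dots> = (\<Sum>i\<in>{0<..<n}. \<Sum>j\<in>{i<..n}. g i j)"
    by (intro sum.cong) auto
  finally show ?thesis .
qed

lemma variation_of_constants:
  assumes "\<nu> < 1"
    and p: "\<And>t. t \<in> nats_from (a + 1) \<Longrightarrow> p t \<noteq> 0"
    and x: "is_Cauchy_function a \<nu> p q x"
    and y: "\<And>t. t \<in> nats_from a \<Longrightarrow> y t = nabla_integral a t (\<lambda>s. x t s * h s)"
  shows "t \<in> nats_from (a + 1) \<Longrightarrow> L_op a \<nu> p q y t = h t"
    and "y a = 0"
    and "nabla y (a + 1) = 0"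
proof -
  define X where "X i = (\<lambda>u. x u (a + real i))" for i
  define H where "H i = h (a + real i)" for i
  have mem: "a + real i \<in> nats_from a" for i
    by (auto simp: nats_from_def)
  have diag: "X i (a + real i) = 0"
    and start: "nabla (X i) (a + real (Suc i)) = 1 / p (a + real (Suc i))" for i
    using x mem[of i] by (auto simp: is_Cauchy_function_def X_def add_ac)
  have LX: "L_op (a + real i) \<nu> p q (X i) (a + real n) = 0" if "i < n" for i n
  proof -
    have "a + real n = a + real i + 1 + real (n - i - 1)"
      using that by simp
    then have "a + real n \<in> nats_from (a + real i + 1)"
      unfolding nats_from_def by blast
    then show ?thesis
      using x mem[of i] unfolding is_Cauchy_function_def X_def by blast
  qed
  have y_full: "y (a + real n) = (\<Sum>i\<in>{0<..n}. X i (a + real n) * H i)" for n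
    by (simp add: y[OF mem] nabla_integral_eq_sum X_def H_def)
  \<comment> \<open>The two forms differ by a vanishing diagonal term. With this one at
    \<open>Suc k\<close> and \<open>y_full\<close> at \<open>k\<close>, both sums run over the same
    indices and can be subtracted termwise.\<close>
  have y_eq: "y (a + real n) = (\<Sum>i\<in>{0<..<n}. X i (a + real n) * H i)" for n
    unfolding y_full by (rule sum.mono_neutral_right) (auto simp: diag order.order_iff_strict)
  have nabla_y: "nabla y (a + real j) = (\<Sum>i\<in>{0<..<j}. nabla (X i) (a + real j) * H i)"
    if "0 < j" for j
  proof -
    obtain k where k: "j = Suc k"
      using \<open>0 < j\<close> by (cases j) auto
    have "{0<..<j} = {0<..k}"
      unfolding k by auto
    then show ?thesis
      using y_eq[of j] y_full[of k] unfolding k nabla_at_Suc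
      by (simp add: sum_subtractf left_diff_distrib del: of_nat_Suc)
  qed
  have caputo_y: "caputo_nabla a \<nu> y (a + real n) =
      (\<Sum>i\<in>{0<..<n}. H i * caputo_nabla (a + real i) \<nu> (X i) (a + real n))" for n
  proof -
    have "caputo_nabla a \<nu> y (a + real n) =
        (\<Sum>j\<in>{0<..n}. \<Sum>i\<in>{0<..<j}. caputo_kernel \<nu> (n - j) * (nabla (X i) (a + real j) * H i))"
      using caputo_nabla_eq_sum[of a 0 \<nu> y n] by (simp add: nabla_y sum_distrib_left)
    also have "\<dots> = (\<Sum>i\<in>{0<..<n}. H i * caputo_nabla (a + real i) \<nu> (X i) (a + real n))"
      unfolding sum_triangle_swap caputo_nabla_eq_sum sum_distrib_left by (simp add: mult_ac)
    finally show ?thesis .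
  qed
  show "L_op a \<nu> p q y t = h t" if "t \<in> nats_from (a + 1)" for t
  proof -
    obtain k where "t = a + 1 + real k"
      using \<open>t \<in> nats_from (a + 1)\<close> by (auto simp: nats_from_def)
    then obtain n where n: "t = a + real n" "0 < n"
      by (intro that[of "Suc k"]) auto
    have "a + real (Suc n) = a + 1 + real n"
      by simp
    then have "p (a + real (Suc n)) \<noteq> 0"
      by (intro p) (auto simp: nats_from_def)
    \<comment> \<open>One step after its base point the Caputo sum has a single term, of weight 1,
      given by the initial condition of the Cauchy function.\<close>
    moreover have "caputo_nabla (a + real n) \<nu> (X n) (a + real (Suc n)) = 1 / p (a + real (Suc n))"
    proof -
      have "{n<..Suc n} = {Suc n}"
        by auto
      then show ?thesis
        using start[of n] caputo_kernel_0[OF \<open>\<nu> < 1\<close>]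
        by (simp add: caputo_nabla_eq_sum del: of_nat_Suc)
    qed
    \<comment> \<open>The index \<open>n\<close> enters only through the Caputo value at
      \<open>Suc n\<close>, and its term is \<open>H n\<close>; the indices below \<open>n\<close>
      assemble into \<open>L_op\<close> terms, which vanish by \<open>LX\<close>.\<close>
    moreover have "{0<..<Suc n} = insert n {0<..<n}"
      using n by auto
    ultimately have "L_op a \<nu> p q y (a + real n) =
        H n + (\<Sum>i\<in>{0<..<n}. H i * L_op (a + real i) \<nu> p q (X i) (a + real n))"
      unfolding L_op_eq caputo_y y_eq
      by (simp add: sum_distrib_left sum.distrib sum_subtractf algebra_simps del: of_nat_Suc)
    then show ?thesis
      by (simp add: LX H_def n)
  qed
  show "y a = 0"
    using y_eq[of 0] by simp
  show "nabla y (a + 1) = 0"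
    using nabla_y[of 1] by (simp add: greaterThanLessThan_eq lessThan_Suc)
qed

theorem theorem20:
  fixes a \<nu> :: real
    and p q h :: "real \<Rightarrow> real"
    and x :: "real \<Rightarrow> real \<Rightarrow> real"
    and y :: "real \<Rightarrow> real"
  assumes "0 < \<nu>" and "\<nu> < 1"
    and "\<And>t. t \<in> nats_from (a + 1) \<Longrightarrow> 0 < p t"
    and "is_Cauchy_function a \<nu> p q x"
  shows "((\<forall>t \<in> nats_from (a + 1). L_op a \<nu> p q y t = h t) \<and> y a = 0 \<and> nabla y (a + 1) = 0)
    \<longleftrightarrow> (\<forall>t \<in> nats_from a. y t = nabla_integral a t (\<lambda>s. x t s * h s))"
proof -
  let ?ivp = "\<lambda>y. (\<forall>t \<in> nats_from (a + 1). L_op a \<nu> p q y t = h t) \<and> y a = 0 \<and> nabla y (a + 1) = 0"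
  let ?I = "\<lambda>t. nabla_integral a t (\<lambda>s. x t s * h s)"
  have p: "p t \<noteq> 0" if "t \<in> nats_from (a + 1)" for t
    using assms(3)[OF that] by simp
  have solution: "?ivp z" if "\<forall>t \<in> nats_from a. z t = ?I t" for z
    using variation_of_constants[OF \<open>\<nu> < 1\<close> p \<open>is_Cauchy_function a \<nu> p q x\<close>, of z h] that
    by blast
  have "y t = ?I t" if "?ivp y" "t \<in> nats_from a" for t
  proof -
    \<comment> \<open>The integral, as a function of its upper limit, is itself a solution and
      serves as the comparison function in \<open>ivp_unique\<close>.\<close>
    have "?ivp ?I"
      by (rule solution) simp
    then have "L_op a \<nu> p q y t = L_op a \<nu> p q ?I t" if "t \<in> nats_from (a + 1)" for t
      using \<open>?ivp y\<close> that by metis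
    moreover have "y a = ?I a" "nabla y (a + 1) = nabla ?I (a + 1)"
      using \<open>?ivp y\<close> \<open>?ivp ?I\<close> by metis+
    ultimately have "y (a + real n) = ?I (a + real n)" for n
      using ivp_unique[where a = a and p = p and q = q and y = y and z = ?I, OF \<open>\<nu> < 1\<close> p] by blast
    with that(2) show ?thesis
      by (auto simp: nats_from_def)
  qed
  with solution[of y] show ?thesis
    by blast
qed

end
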